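(* Let $p,q\geq 2$ be relatively prime integers. Then the numerical semigroup $G(p,q)$ generated by $p$ and $q$ is representable.
   Context: A numerical semigroup is a submonoid of $\mathbb{N}=\{0,1,2,\dots\}$ with finite complement. Representable semigroups. For a normal weighted homogeneous surface singularity $(X,0)$ (germ at the origin of an affine surface with good effective $\mathbb{C}^*$-action, so that its coordinate ring is graded, $R_X=\bigoplus_{\ell\geq 0}R_{X,\ell}$) whose link is a rational homology sphere, put $\mathcal{S}_{(X,0)}=\{\ell\geq 0: R_{X,\ell}\neq 0\}$. A numerical semigroup is representable if it equals some such $\mathcal{S}_{(X,0)}$. By Pinkham this is equivalent to the following combinatorial description. An SSR graph $\Gamma$ is a negative definite star-shaped plumbing graph with all genera zero, determined by normalized Seifert invariants $Sf=(-b_0;(\alpha_i,\omega_i)_{i=1}^d)$, where $b_0\in\mathbb{Z}_{>0}$, $d\geq 3$, $0<\omega_i<\alpha_i$, $\gcd(\alpha_i,\omega_i)=1$, and $e:=-b_0+\sum_{i=1}^d\omega_i/\alpha_i<0$ (negative definiteness). Its quasi-linear function is $N(\ell)=b_0\ell-\sum_{i=1}^d\lceil \ell\omega_i/\alpha_i\rceil$, and $\mathcal{S}_\Gamma=\{\ell\in\mathbb{Z}: N(\ell)\geq 0\}$ (contained in $\mathbb{N}$). A numerical semigroup is representable iff it equals $\mathcal{S}_\Gamma$ for some SSR graph $\Gamma$. *)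

theory Defs
  imports Complex_Main "HOL.Hull"
begin

definition submonoid_nat :: "nat set \<Rightarrow> bool" where
  "submonoid_nat S \<longleftrightarrow> 0 \<in> S \<and> (\<forall>x\<in>S. \<forall>y\<in>S. x + y \<in> S)"

definition numerical_semigroup :: "nat set \<Rightarrow> bool" where
  "numerical_semigroup S \<longleftrightarrow> submonoid_nat S \<and> finite (UNIV - S)"

definition generated_semigroup :: "nat set \<Rightarrow> nat set" where
  "generated_semigroup A = submonoid_nat hull A"

abbreviation G :: "nat \<Rightarrow> nat \<Rightarrow> nat set" where
  "G p q \<equiv> generated_semigroup {p, q}"

text \<open>
  A star-shaped plumbing graph with all genera zero is encoded by its Seifert invariants
  Sf = (- b0; (alpha_1, omega_1), ..., (alpha_d, omega_d)): the field b0 is the number b0 itself,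
  so that the central vertex has decoration - b0, and the pair (alpha_i, omega_i) is the i-th
  entry of the list legs, so that d is the length of that list.
\<close>

datatype seifert = Seifert (b0: int) (legs: "(int \<times> int) list")

definition orbifold_euler :: "seifert \<Rightarrow> rat" where
  "orbifold_euler \<Gamma> =
     - of_int (b0 \<Gamma>) + (\<Sum>(\<alpha>, \<omega>)\<leftarrow>legs \<Gamma>. of_int \<omega> / of_int \<alpha>)"

text \<open>For normalized invariants, negative definiteness of the graph is the condition e < 0.\<close>

definition SSR_graph :: "seifert \<Rightarrow> bool" where
  "SSR_graph \<Gamma> \<longleftrightarrow>
     b0 \<Gamma> > 0 \<and> length (legs \<Gamma>) \<ge> 3 \<and>
     (\<forall>(\<alpha>, \<omega>)\<in>set (legs \<Gamma>). 0 < \<omega> \<and> \<omega> < \<alpha> \<and> coprime \<alpha> \<omega>) \<and>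
     orbifold_euler \<Gamma> < 0"

definition quasi_linear :: "seifert \<Rightarrow> int \<Rightarrow> int" where
  "quasi_linear \<Gamma> l =
     b0 \<Gamma> * l - (\<Sum>(\<alpha>, \<omega>)\<leftarrow>legs \<Gamma>. \<lceil>(of_int (l * \<omega>) / of_int \<alpha> :: rat)\<rceil>)"

definition graph_semigroup :: "seifert \<Rightarrow> int set" where
  "graph_semigroup \<Gamma> = {l. quasi_linear \<Gamma> l \<ge> 0}"

text \<open>
  Representability means being the set of degrees of nonzero homogeneous elements of the graded
  coordinate ring of a normal weighted homogeneous surface singularity with rational homology
  sphere link. It is stated here in the equivalent form, due to Pinkham, in terms of the
  associated star-shaped graph.
\<close>

definition representable :: "nat set \<Rightarrow> bool" where
  "representable S \<longleftrightarrow>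
     numerical_semigroup S \<and> (\<exists>\<Gamma>. SSR_graph \<Gamma> \<and> int ` S = graph_semigroup \<Gamma>)"

end

theory Submission
  imports Defs
begin

text \<open>
  Choose \<open>\<omega>\<^sub>1, \<omega>\<^sub>2\<close> with \<open>q\<omega>\<^sub>1 + p\<omega>\<^sub>2 = pq - 1\<close>. The function
  \<open>N(l) = l - \<lceil>l\<omega>\<^sub>1/p\<rceil> - \<lceil>l\<omega>\<^sub>2/q\<rceil>\<close> of the two-legged graph of the smooth germ with weights
  \<open>p, q\<close> is nonnegative exactly on \<open>G(p,q)\<close>, and it is nonnegative for all \<open>l \<ge> pq\<close>. A third leg
  \<open>(pq, pq - 1)\<close> together with \<open>b\<^sub>0 = 2\<close> adds \<open>\<lfloor>l/(pq)\<rfloor>\<close> to \<open>N(l)\<close>, which does not change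
  the set of \<open>l\<close> with \<open>N(l) \<ge> 0\<close>.
\<close>

lemma generated_semigroup_pair:
  "G p q = {l. \<exists>x y. l = x * p + y * q}" (is "_ = ?S")
  unfolding generated_semigroup_def
proof (rule hull_unique)
  have "p = 1 * p + 0 * q" "q = 0 * p + 1 * q" by simp_all
  then show "{p, q} \<subseteq> ?S" by blast
  have "0 = 0 * p + 0 * q" by simp
  moreover have "(x * p + y * q) + (x' * p + y' * q) = (x + x') * p + (y + y') * q" for x y x' y'
    by (simp add: algebra_simps)
  ultimately show "submonoid_nat ?S"
    unfolding submonoid_nat_def by blast
next
  fix T assume T: "{p, q} \<subseteq> T" "submonoid_nat T"
  have mult: "x * m \<in> T" if "m \<in> T" for x m
    using that T(2) by (induction x) (auto simp: submonoid_nat_def)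
  show "?S \<subseteq> T"
    using T mult[of p] mult[of q] by (auto simp: submonoid_nat_def)
qed

lemma int_image_G_iff:
  "l \<in> int ` G p q \<longleftrightarrow> (\<exists>x\<ge>0. \<exists>y\<ge>0. l = x * int p + y * int q)"
proof
  assume "\<exists>x\<ge>0. \<exists>y\<ge>0. l = x * int p + y * int q"
  then obtain x y where "x \<ge> 0" "y \<ge> 0" "l = x * int p + y * int q" by blast
  then have "l = int (nat x * p + nat y * q)" by simp
  then show "l \<in> int ` G p q" unfolding generated_semigroup_pair by blast
next
  assume "l \<in> int ` G p q"
  then obtain x y where "l = int (x * p + y * q)"
    unfolding generated_semigroup_pair by blast
  then have "l = int x * int p + int y * int q" by simp
  then show "\<exists>x\<ge>0. \<exists>y\<ge>0. l = x * int p + y * int q"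
    using of_nat_0_le_iff by blast
qed

text \<open>Negating a Bezout relation for \<open>q\<close> and \<open>p\<close> and adding
  \<open>p * q\<close> gives some solution; reducing the coefficient of \<open>q\<close> modulo
  \<open>p\<close> puts it in range, and the size of \<open>p * q - 1\<close> then forces the other
  one into range. The strict bounds make \<open>(p, u)\<close> and \<open>(q, v)\<close> normalized
  legs.\<close>

lemma seifert_weights_exist:
  fixes p q :: int
  assumes "p \<ge> 2" "q \<ge> 2" "coprime p q"
  obtains u v where "u * q + v * p = p * q - 1" "0 < u" "u < p" "0 < v" "v < q"
proof -
  obtain a b where ab: "a * q + b * p = 1"
    using bezout_int[of q p] assms(3) by (auto simp: coprime_iff_gcd_eq_1 gcd.commute)
  define u where "u = (- a) mod p"
  define w where "w = (- a) div p"
  have a: "a = - u - p * w"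
    unfolding u_def w_def using mult_div_mod_eq[of p "-a"] by linarith
  have eq: "u * q + (q - b + q * w) * p = p * q - 1"
    using ab unfolding a by (simp add: algebra_simps)
  have u: "0 \<le> u" "u < p" using assms(1) unfolding u_def by simp_all
  have "u \<noteq> 0"
  proof
    assume "u = 0"
    then have "p * (q - (q - b + q * w)) = 1" using eq by (simp add: algebra_simps)
    then have "p dvd 1" by (metis dvd_triv_left)
    then show False using assms(1) by simp
  qed
  then have "u > 0" using u by simp
  define v where "v = q - b + q * w"
  have e: "u * q + v * p = p * q - 1" using eq unfolding v_def .
  \<comment> \<open>Since \<open>u\<close> is at most \<open>p - 1\<close>, the product
    \<open>v * p\<close> is at least \<open>q - 1\<close>, hence positive.\<close>
  have "u * q \<le> (p - 1) * q" using u assms by (intro mult_right_mono) auto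
  then have "v * p > 0" using e assms by (simp add: algebra_simps)
  then have "v > 0" using assms by (simp add: zero_less_mult_iff)
  have "u * q > 0" using \<open>u > 0\<close> assms by simp
  then have "v * p < q * p" using e by (simp add: algebra_simps)
  then have "v < q" using assms by simp
  from that[OF e \<open>u > 0\<close> u(2) \<open>v > 0\<close> this] show thesis .
qed

text \<open>The slacks of the two inequalities are the coefficients, crosswise:
  \<open>x = q * B - l * v\<close> and \<open>y = p * A - l * u\<close>. Weighted by
  \<open>p\<close> and \<open>q\<close> they add up to
  \<open>p * q * l - l * (p * q - 1) = l\<close>.\<close>

lemma nonneg_combination_iff:
  fixes p q u v l :: int
  assumes "u * q + v * p = p * q - 1"
  shows "(\<exists>x\<ge>0. \<exists>y\<ge>0. l = x * p + y * q) \<longleftrightarrow>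
         (\<exists>A B. A + B = l \<and> l * u \<le> p * A \<and> l * v \<le> q * B)"
proof
  assume "\<exists>x\<ge>0. \<exists>y\<ge>0. l = x * p + y * q"
  then obtain x y where xy: "x \<ge> 0" "y \<ge> 0" and l: "l = x * p + y * q" by blast
  \<comment> \<open>Solving \<open>p * A - l * u = y\<close> and \<open>q * B - l * v = x\<close>
    for \<open>A\<close> and \<open>B\<close>; the divisions are exact because
    \<open>1 + q * u = p * (q - v)\<close> and \<open>1 + p * v = q * (p - u)\<close>.\<close>
  define A where "A = x * u + y * (q - v)"
  define B where "B = x * (p - u) + y * v"
  have "A + B = l" unfolding A_def B_def l by (simp add: algebra_simps)
  moreover have "p * A - l * u = y"
  proof -
    have "p * A - l * u = y * (p * q - (u * q + v * p))"
      unfolding A_def l by (simp add: algebra_simps)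
    then show ?thesis using assms by simp
  qed
  moreover have "q * B - l * v = x"
  proof -
    have "q * B - l * v = x * (p * q - (u * q + v * p))"
      unfolding B_def l by (simp add: algebra_simps)
    then show ?thesis using assms by simp
  qed
  ultimately show "\<exists>A B. A + B = l \<and> l * u \<le> p * A \<and> l * v \<le> q * B"
    using xy by (intro exI[of _ A] exI[of _ B]) linarith
next
  assume "\<exists>A B. A + B = l \<and> l * u \<le> p * A \<and> l * v \<le> q * B"
  then obtain A B where AB: "A + B = l" "l * u \<le> p * A" "l * v \<le> q * B" by blast
  have "(q * B - l * v) * p + (p * A - l * u) * q = p * q * (A + B) - l * (u * q + v * p)"
    by (simp add: algebra_simps)
  also have "\<dots> = l" unfolding assms AB(1) by (simp add: algebra_simps)
  finally have "l = (q * B - l * v) * p + (p * A - l * u) * q" ..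
  moreover have "q * B - l * v \<ge> 0" "p * A - l * u \<ge> 0" using AB by simp_all
  ultimately show "\<exists>x\<ge>0. \<exists>y\<ge>0. l = x * p + y * q" by blast
qed

lemma ceiling_divide_le_iff:
  fixes a b k :: int
  assumes "b > 0"
  shows "\<lceil>(of_int a / of_int b :: rat)\<rceil> \<le> k \<longleftrightarrow> a \<le> b * k"
proof -
  have "\<lceil>(of_int a / of_int b :: rat)\<rceil> \<le> k \<longleftrightarrow> (of_int a :: rat) \<le> of_int (b * k)"
    using assms by (simp add: ceiling_le_iff field_simps)
  then show ?thesis by (simp only: of_int_le_iff)
qed

text \<open>Two integers sum to at most \<open>l\<close> exactly when \<open>l\<close> splits into
  two parts dominating them; bounding each ceiling by its part is then an integer inequality as in
  \<open>nonneg_combination_iff\<close>.\<close>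

lemma ceiling_sum_le_iff:
  fixes p q u v l :: int
  assumes "p > 0" "q > 0" "u * q + v * p = p * q - 1"
  shows "\<lceil>(of_int (l * u) / of_int p :: rat)\<rceil> + \<lceil>(of_int (l * v) / of_int q :: rat)\<rceil> \<le> l \<longleftrightarrow>
         (\<exists>x\<ge>0. \<exists>y\<ge>0. l = x * p + y * q)" (is "?A + ?B \<le> l \<longleftrightarrow> _")
proof -
  have "?A + ?B \<le> l \<longleftrightarrow> (\<exists>A B. A + B = l \<and> ?A \<le> A \<and> ?B \<le> B)"
  proof
    assume "?A + ?B \<le> l"
    then show "\<exists>A B. A + B = l \<and> ?A \<le> A \<and> ?B \<le> B"
      by (intro exI[of _ ?A] exI[of _ "l - ?A"]) linarith
  qed linarith
  then show ?thesis
    unfolding nonneg_combination_iff[OF assms(3)]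
    by (simp only: ceiling_divide_le_iff[OF assms(1)] ceiling_divide_le_iff[OF assms(2)])
qed

text \<open>The two fractions add up to \<open>l - l / (p * q)\<close>, which is at most
  \<open>l - 1\<close>, and each rounding adds less than 1. So the integer sum is below
  \<open>l + 1\<close>.\<close>

lemma ceiling_sum_le_large:
  fixes p q u v l :: int
  assumes "p > 0" "q > 0" "u * q + v * p = p * q - 1" "l \<ge> p * q"
  shows "\<lceil>(of_int (l * u) / of_int p :: rat)\<rceil> + \<lceil>(of_int (l * v) / of_int q :: rat)\<rceil> \<le> l"
    (is "?A + ?B \<le> l")
proof -
  have "l * u > p * (?A - 1)" "l * v > q * (?B - 1)"
    using ceiling_divide_le_iff[OF assms(1), of "l * u" "?A - 1"]
      ceiling_divide_le_iff[OF assms(2), of "l * v" "?B - 1"] by linarith+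
  \<comment> \<open>Strict integer inequalities gain a unit, cleared here to the common denominator
    \<open>p * q\<close>.\<close>
  then have "q * (p * (?A - 1) + 1) \<le> q * (l * u)" "p * (q * (?B - 1) + 1) \<le> p * (l * v)"
    using assms(1,2) by (intro mult_left_mono; simp)+
  then have "p * q * (?A + ?B - 2) + p + q \<le> l * (u * q + v * p)"
    by (simp add: algebra_simps)
  also have "\<dots> = p * q * l - l" unfolding assms(3) by (simp add: algebra_simps)
  finally have "p * q * (?A + ?B - 2) < p * q * l - p * q"
    using assms by linarith
  then have "p * q * (?A + ?B - 1) < p * q * l" by (simp add: algebra_simps)
  then have "?A + ?B - 1 < l" using assms(1,2) by simp
  then show ?thesis by simp
qed

text \<open>The fraction is \<open>l - l / n\<close>, and rounding up turns into rounding down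
  behind the minus sign.\<close>

lemma ceiling_pred_leg:
  fixes n l :: int
  assumes "n > 0"
  shows "\<lceil>(of_int (l * (n - 1)) / of_int n :: rat)\<rceil> = l - l div n"
proof -
  have "- (l * (n - 1)) = l + (- l) * n" by (simp add: algebra_simps)
  then have "(- (l * (n - 1))) div n = l div n - l"
    using assms by (metis add.commute div_mult_self1 less_irrefl uminus_add_conv_diff)
  then show ?thesis by (simp only: ceiling_divide_eq_div minus_diff_eq)
qed

theorem corollary3p2p2:
  fixes p q :: nat
  assumes "p \<ge> 2" and "q \<ge> 2" and "coprime p q"
  shows "representable (G p q)"
proof -
  define P Q where "P = int p" and "Q = int q"
  have PQ: "P \<ge> 2" "Q \<ge> 2" "coprime P Q" using assms by (simp_all add: P_def Q_def)
  then obtain u v where uv: "u * Q + v * P = P * Q - 1" "0 < u" "u < P" "0 < v" "v < Q"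
    by (rule seifert_weights_exist)
  have PQ2: "P * Q \<ge> 2 * 2" using PQ by (intro mult_mono) auto
  define \<Gamma> where "\<Gamma> = Seifert 2 [(P, u), (Q, v), (P * Q, P * Q - 1)]"
  define N where "N l = l - \<lceil>(of_int (l * u) / of_int P :: rat)\<rceil> -
    \<lceil>(of_int (l * v) / of_int Q :: rat)\<rceil>" for l
  have mem: "l \<in> int ` G p q \<longleftrightarrow> N l \<ge> 0" for l
  proof -
    have "l \<in> int ` G p q \<longleftrightarrow> (\<exists>x\<ge>0. \<exists>y\<ge>0. l = x * P + y * Q)"
      unfolding int_image_G_iff P_def Q_def ..
    also have "\<dots> \<longleftrightarrow> \<lceil>(of_int (l * u) / of_int P :: rat)\<rceil> +
        \<lceil>(of_int (l * v) / of_int Q :: rat)\<rceil> \<le> l"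
      using PQ by (intro ceiling_sum_le_iff[OF _ _ uv(1), symmetric]) auto
    also have "\<dots> \<longleftrightarrow> N l \<ge> 0" unfolding N_def by linarith
    finally show ?thesis .
  qed
  have large: "N l \<ge> 0" if "l \<ge> P * Q" for l
    using ceiling_sum_le_large[OF _ _ uv(1) that] PQ unfolding N_def by linarith
  have quasi: "quasi_linear \<Gamma> l = N l + l div (P * Q)" for l
  proof -
    have "quasi_linear \<Gamma> l = N l + l - \<lceil>(of_int (l * (P * Q - 1)) / of_int (P * Q) :: rat)\<rceil>"
      unfolding quasi_linear_def \<Gamma>_def N_def by simp
    then show ?thesis using ceiling_pred_leg[of "P * Q" l] PQ2 by linarith
  qed
  have "quasi_linear \<Gamma> l \<ge> 0 \<longleftrightarrow> N l \<ge> 0" for l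
  proof -
    \<comment> \<open>\<open>div\<close> rounds towards minus infinity, so the extra term is
      negative, zero and positive in the three ranges. For negative \<open>l\<close> the value
      \<open>N l\<close> is negative as well, since \<open>l\<close> is not in the image of
      \<open>int\<close>; in the last range \<open>N l\<close> is already nonnegative.\<close>
    consider "l < 0" | "0 \<le> l" "l < P * Q" | "l \<ge> P * Q" by linarith
    then show ?thesis
    proof cases
      case 1
      then have "l div (P * Q) < 0" using PQ2 by (intro div_neg_pos_less0) linarith+
      moreover have "N l < 0" using mem[of l] 1 by fastforce
      ultimately show ?thesis unfolding quasi by linarith
    next
      case 2
      then show ?thesis unfolding quasi by simp
    next
      case 3
      then have "l div (P * Q) \<ge> 0" using PQ2 by (simp add: pos_imp_zdiv_nonneg_iff)
      then show ?thesis using large[OF 3] unfolding quasi by linarith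
    qed
  qed
  then have eq: "int ` G p q = graph_semigroup \<Gamma>"
    unfolding graph_semigroup_def using mem by blast
  have "submonoid_nat (G p q)"
    unfolding generated_semigroup_def by (rule hull_in) (auto simp: submonoid_nat_def)
  \<comment> \<open>All gaps lie below \<open>p * q\<close>, so the complement is finite.\<close>
  moreover have "UNIV - G p q \<subseteq> {..<p * q}"
  proof
    fix l assume "l \<in> UNIV - G p q"
    then have "N (int l) < 0" using mem[of "int l"] by force
    then have "int l < int (p * q)" using large[of "int l"] by (force simp: P_def Q_def)
    then show "l \<in> {..<p * q}" by (simp only: of_nat_less_iff lessThan_iff)
  qed
  ultimately have "numerical_semigroup (G p q)"
    unfolding numerical_semigroup_def using finite_subset by blast
  moreover have "SSR_graph \<Gamma>"
  proof -
    have "coprime P u"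
    proof (rule coprimeI)
      fix c assume "c dvd P" "c dvd u"
      \<comment> \<open>This difference equals 1 by the choice of \<open>u\<close> and
        \<open>v\<close>.\<close>
      then have "c dvd P * Q - (u * Q + v * P)" by simp
      then show "is_unit c" using uv(1) by simp
    qed
    moreover have "coprime Q v"
    proof (rule coprimeI)
      fix c assume "c dvd Q" "c dvd v"
      then have "c dvd P * Q - (u * Q + v * P)" by simp
      then show "is_unit c" using uv(1) by simp
    qed
    moreover have "coprime (P * Q) (P * Q - 1)"
    proof (rule coprimeI)
      fix c assume "c dvd P * Q" "c dvd P * Q - 1"
      then have "c dvd P * Q - (P * Q - 1)" by (rule dvd_diff)
      then show "is_unit c" by simp
    qed
    moreover have "orbifold_euler \<Gamma> < 0"
    proof -
      \<comment> \<open>The first two legs together contribute \<open>1 - 1 / (P * Q)\<close>, as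
        much as the third one alone, so the orbifold Euler number is
        \<open>- 2 / (P * Q)\<close>.\<close>
      have "(of_int (u * Q + v * P) :: rat) = of_int (P * Q - 1)" using uv(1) by simp
      then have "(of_int u / of_int P + of_int v / of_int Q :: rat) = of_int (P * Q - 1) / of_int (P * Q)"
        using PQ by (simp add: field_simps)
      then have "orbifold_euler \<Gamma> = - 2 + 2 * (of_int (P * Q - 1) / of_int (P * Q))"
        unfolding orbifold_euler_def \<Gamma>_def
        by (simp del: of_int_mult of_int_diff add: add.assoc [symmetric])
      moreover have "(of_int (P * Q - 1) / of_int (P * Q) :: rat) < 1"
        using PQ2 by (subst divide_less_eq_1) (simp only: of_int_less_iff of_int_0_less_iff; simp)
      ultimately show ?thesis by linarith
    qed
    ultimately show ?thesis
      using uv PQ2 unfolding SSR_graph_def \<Gamma>_def by (simp del: coprime_mult_left_iff)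
  qed
  ultimately show ?thesis using eq unfolding representable_def by blast
qed

end
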